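(* Let $X$ be a locally compact Polish metric space, $\mu_1,\mu_2\in \mathcal{M}(X)$, $a,b>0$, and let $c_1: X\times X\to [0,+\infty]$ be a lower semi-continuous function. Let $\hat X$, $\hat c_1$, $\hat\mu_1,\hat\mu_2$ and $\Gamma(\hat\mu_1,\hat\mu_2)$ be as defined in the context. Then $$\sup\left\{\sum_{i=1}^2\int_{\hat{X}}\hat{\varphi}_i\,d\hat{\mu}_i \;:\; (\hat{\varphi}_1,\hat{\varphi}_2)\in L^1(\hat{\mu}_1)\times L^1(\hat{\mu}_2),\ \hat{\varphi}_1(x)+\hat{\varphi}_2(y)\leq \hat{c}_1(x,y)\ \text{for all } x,y\in\hat X\right\}= \inf_{\hat{\boldsymbol{\gamma}}\in \Gamma(\hat{\mu}_1,\hat{\mu}_2)}\int_{\hat{X}\times \hat{X}}\hat{c}_1(x,y)\,d\hat{\boldsymbol{\gamma}}(x,y).$$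
   Context: $\mathcal{M}(X)$ is the set of nonnegative finite Borel measures on $X$, and $|\mu|:=\mu(X)$ is the mass of $\mu\in\mathcal{M}(X)$. $\hat X:=X\cup\{\hat\infty\}$ is obtained by attaching an isolated point $\hat\infty$ to $X$. The extended cost $\hat c_1:\hat X\times\hat X\to[0,+\infty]$ is: $\hat c_1(x,y)=b\,c_1(x,y)$ if $x\ne\hat\infty$ and $y\neq\hat\infty$; $\hat c_1(x,y)=a$ if $x\in X,\ y=\hat\infty$ or $x=\hat\infty,\ y\in X$; and $\hat c_1(\hat\infty,\hat\infty)=0$. The extended measures are $\hat\mu_1:=\mu_1+|\mu_2|\delta_{\hat\infty}$ and $\hat\mu_2:=\mu_2+|\mu_1|\delta_{\hat\infty}$ (which have equal mass). $\Gamma(\hat\mu_1,\hat\mu_2)$ is the set of $\hat{\boldsymbol\gamma}\in\mathcal{M}(\hat X\times\hat X)$ with $\hat{\boldsymbol\gamma}(A\times\hat X)=\hat\mu_1(A)$ and $\hat{\boldsymbol\gamma}(\hat X\times A)=\hat\mu_2(A)$ for all Borel $A\subset\hat X$. *)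

theory Defs
  imports "HOL-Probability.Probability"
begin

text \<open>
  The space X with an isolated point attached is \<^typ>\<open>'a option\<close>: \<^term>\<open>None\<close> is the
  additional point, \<^term>\<open>Some\<close> the inclusion of X.  A set is open iff its trace on X is,
  so \<^term>\<open>{None}\<close> and \<^term>\<open>range Some\<close> are both open and closed, and the subspace
  topology on \<^term>\<open>range Some\<close> is that of X.
\<close>

instantiation option :: (topological_space) topological_space
begin

definition open_option :: "'a option set \<Rightarrow> bool" where
  "open_option U \<longleftrightarrow> open (Some -` U)"

instance
  by standard (auto simp: open_option_def vimage_Union vimage_Int)

end

definition finite_borel_measures :: "'a::topological_space measure set" where
  "finite_borel_measures = {\<mu>. sets \<mu> = sets borel \<and> finite_measure \<mu>}"

definition lower_semicontinuous :: "('a::topological_space \<Rightarrow> ennreal) \<Rightarrow> bool" where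
  "lower_semicontinuous f \<longleftrightarrow> (\<forall>t. open {x. t < f x})"

fun hat_cost :: "real \<Rightarrow> real \<Rightarrow> ('a \<times> 'a \<Rightarrow> ennreal) \<Rightarrow> 'a option \<times> 'a option \<Rightarrow> ennreal" where
  "hat_cost a b c (Some x, Some y) = ennreal b * c (x, y)"
| "hat_cost a b c (Some x, None) = ennreal a"
| "hat_cost a b c (None, Some y) = ennreal a"
| "hat_cost a b c (None, None) = 0"

definition add_measure :: "'a measure \<Rightarrow> 'a measure \<Rightarrow> 'a measure" where
  "add_measure \<mu> \<nu> = measure_of (space \<mu>) (sets \<mu>) (\<lambda>A. emeasure \<mu> A + emeasure \<nu> A)"

text \<open>
  \<^term>\<open>measure_of\<close> yields the zero measure unless the given set function is a measure;
  this is the case for summands with the same measurable sets.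
\<close>

lemma sets_add_measure [simp]: "sets (add_measure \<mu> \<nu>) = sets \<mu>"
  by (simp add: add_measure_def)

lemma space_add_measure [simp]: "space (add_measure \<mu> \<nu>) = space \<mu>"
  by (simp add: add_measure_def)

lemma emeasure_add_measure:
  assumes "sets \<mu> = sets \<nu>" "A \<in> sets \<mu>"
  shows "emeasure (add_measure \<mu> \<nu>) A = emeasure \<mu> A + emeasure \<nu> A"
  using add_measure_def
proof (rule emeasure_measure_of)
  show "countably_additive (sets (add_measure \<mu> \<nu>)) (\<lambda>A. emeasure \<mu> A + emeasure \<nu> A)"
  proof (rule countably_additiveI)
    fix B :: "nat \<Rightarrow> 'a set"
    assume B: "range B \<subseteq> sets (add_measure \<mu> \<nu>)" "disjoint_family B"
    then have "(\<Sum>i. emeasure \<mu> (B i)) = emeasure \<mu> (\<Union>i. B i)"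
      and "(\<Sum>i. emeasure \<nu> (B i)) = emeasure \<nu> (\<Union>i. B i)"
      using assms(1) by (auto intro!: suminf_emeasure)
    then show "(\<Sum>i. emeasure \<mu> (B i) + emeasure \<nu> (B i)) =
        emeasure \<mu> (\<Union>i. B i) + emeasure \<nu> (\<Union>i. B i)"
      by (simp add: suminf_add[symmetric])
  qed
qed (use assms in \<open>auto simp: positive_def dest: sets.sets_into_space\<close>)

text \<open>\<open>hat_measure \<mu> \<nu>\<close> is \<open>\<mu> + |\<nu>| \<delta>\<close> with \<open>\<delta>\<close> the Dirac measure at \<^term>\<open>None\<close>.\<close>

definition hat_measure ::
    "'a::topological_space measure \<Rightarrow> 'a measure \<Rightarrow> 'a option measure" where
  "hat_measure \<mu> \<nu> =
     add_measure (distr \<mu> borel Some)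
       (scale_measure (emeasure \<nu> (space \<nu>)) (return borel None))"

lemma measurable_Some_borel: "Some \<in> borel \<rightarrow>\<^sub>M borel"
  by (rule borel_measurableI) (simp add: open_option_def)

lemma emeasure_hat_measure:
  assumes "sets \<mu> = sets borel" "A \<in> sets borel"
  shows "emeasure (hat_measure \<mu> \<nu>) A =
    emeasure \<mu> (Some -` A) + emeasure \<nu> (space \<nu>) * indicator A None"
proof -
  have "Some \<in> \<mu> \<rightarrow>\<^sub>M borel"
    using measurable_Some_borel measurable_cong_sets[OF assms(1) refl] by blast
  moreover have "space \<mu> = UNIV"
    using sets_eq_imp_space_eq[OF assms(1)] by simp
  ultimately show ?thesis
    using assms by (simp add: hat_measure_def emeasure_add_measure emeasure_distr)
qed

lemma hat_measure_in_finite_borel_measures: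
  assumes "\<mu> \<in> finite_borel_measures" "\<nu> \<in> finite_borel_measures"
  shows "hat_measure \<mu> \<nu> \<in> finite_borel_measures"
proof -
  have "sets (hat_measure \<mu> \<nu>) = sets borel"
    by (simp add: hat_measure_def)
  moreover from this have "space (hat_measure \<mu> \<nu>) = UNIV"
    using sets_eq_imp_space_eq by fastforce
  ultimately show ?thesis
    using assms unfolding finite_borel_measures_def
    by (auto intro!: finite_measureI
        simp: emeasure_hat_measure ennreal_mult_eq_top_iff finite_measure.emeasure_finite)
qed

definition couplings ::
    "'a::topological_space measure \<Rightarrow> 'a measure \<Rightarrow> ('a \<times> 'a) measure set" where
  "couplings \<mu> \<nu> = {\<gamma> \<in> finite_borel_measures.
     \<forall>A \<in> sets borel. emeasure \<gamma> (A \<times> UNIV) = emeasure \<mu> A \<and>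
                      emeasure \<gamma> (UNIV \<times> A) = emeasure \<nu> A}"

end

theory Submission
  imports Defs
begin

text \<open>
  Weak duality is integration of \<open>\<phi>(x) + \<psi>(y) \<le> c(x, y)\<close> against a coupling.  Conversely, let the
  dual supremum \<open>D\<close> be finite.  On the bounded functions \<open>f\<close> on the product, the infimum of
  \<open>\<integral>\<phi> d\<mu> + \<integral>\<psi> d\<nu> + t D\<close> subject to \<open>f \<le> \<phi> \<oplus> \<psi> + t c\<close> and \<open>t \<ge> 0\<close> is sublinear, and it is nonnegative
  at \<open>0\<close> precisely because \<open>D\<close> bounds the dual problem.  By Hahn-Banach it dominates a linear
  functional \<open>L\<close>; this \<open>L\<close> is positive, has the right marginals, and satisfies \<open>L f \<le> D\<close> whenever
  \<open>f \<le> c\<close>.  The finitely additive content \<open>E \<mapsto> L 1\<^sub>E\<close> has compact inner regular marginals, so it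
  is countably additive on an algebra containing the measurable rectangles and extends to a
  coupling \<open>\<gamma>\<close>.  Finally \<open>c\<close>, being lower semicontinuous, is an increasing limit of step functions
  over open rectangles, on which \<open>L\<close> and \<open>\<gamma>\<close> agree; hence \<open>\<integral>c d\<gamma> \<le> D\<close>.
\<close>

section \<open>Hahn-Banach for function spaces\<close>

text \<open>A linear space given as a set of functions closed under pointwise operations. In the
  application it consists of all bounded functions on the product, measurable or not.\<close>

locale function_space =
  fixes V :: "('z \<Rightarrow> real) set"
  assumes zero: "(\<lambda>_. 0) \<in> V"
    and add: "f \<in> V \<Longrightarrow> g \<in> V \<Longrightarrow> (\<lambda>z. f z + g z) \<in> V"
    and scale: "f \<in> V \<Longrightarrow> (\<lambda>z. r * f z) \<in> V"
begin

lemma uminus: "f \<in> V \<Longrightarrow> (\<lambda>z. - f z) \<in> V"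
  using scale[of f "-1"] by simp

text \<open>One inequality for \<open>r > 0\<close> suffices: using it with \<open>1 / r\<close>
  gives the reverse, and \<open>r = 2\<close> and \<open>r = 1 / 2\<close> at the zero function give
  the value \<open>0\<close> there.\<close>

definition sublinear :: "(('z \<Rightarrow> real) \<Rightarrow> real) \<Rightarrow> bool" where
  "sublinear q \<longleftrightarrow> (\<forall>f\<in>V. \<forall>g\<in>V. q (\<lambda>z. f z + g z) \<le> q f + q g) \<and>
     (\<forall>f\<in>V. \<forall>r>0. q (\<lambda>z. r * f z) \<le> r * q f)"

lemma sublinear_add: "sublinear q \<Longrightarrow> f \<in> V \<Longrightarrow> g \<in> V \<Longrightarrow> q (\<lambda>z. f z + g z) \<le> q f + q g"
  by (auto simp: sublinear_def)

lemma sublinear_zero: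
  assumes "sublinear q"
  shows "q (\<lambda>_. 0) = 0"
proof -
  have *: "q (\<lambda>_. 0) \<le> r * q (\<lambda>_. 0)" if "r > 0" for r
  proof -
    have "\<forall>f\<in>V. \<forall>r>0. q (\<lambda>z. r * f z) \<le> r * q f"
      using assms by (simp add: sublinear_def)
    from this[rule_format, OF zero that] show ?thesis by simp
  qed
  show ?thesis using *[of 2] *[of "1/2"] by simp
qed

lemma sublinear_scale:
  assumes "sublinear q" "f \<in> V" "r \<ge> 0"
  shows "q (\<lambda>z. r * f z) = r * q f"
proof (cases "r = 0")
  case True
  then show ?thesis using sublinear_zero[OF assms(1)] by simp
next
  case False
  then have r: "r > 0" using assms by simp
  have 1: "q (\<lambda>z. r * f z) \<le> r * q f"
    using assms r unfolding sublinear_def by blast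
  have "q (\<lambda>z. (1/r) * (\<lambda>z. r * f z) z) \<le> (1/r) * q (\<lambda>z. r * f z)"
    using assms(1) r scale[OF assms(2)] unfolding sublinear_def
    by (metis zero_less_divide_1_iff)
  then have "r * q f \<le> q (\<lambda>z. r * f z)"
    using r by (simp add: field_simps)
  then show ?thesis using 1 by simp
qed

lemma sublinear_uminus:
  assumes "sublinear q" "f \<in> V"
  shows "0 \<le> q f + q (\<lambda>z. - f z)"
  using sublinear_add[OF assms uminus[OF assms(2)]] sublinear_zero[OF assms(1)] by simp

text \<open>A minimal sublinear functional is odd, since \<open>g \<mapsto> inf {q (g + t f) - t q f | t \<ge> 0}\<close>
  is sublinear and below \<open>q\<close>, and its value at \<open>- f\<close> is at most \<open>- q f\<close>.\<close>

lemma sublinear_descent: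
  assumes q: "sublinear q" and f: "f \<in> V"
  obtains q' where "sublinear q'" "\<And>g. g \<in> V \<Longrightarrow> q' g \<le> q g" "q' (\<lambda>z. - f z) \<le> - q f"
proof -
  define h where "h g t = q (\<lambda>z. g z + t * f z) - t * q f" for g t
  define q' where "q' g = (INF t\<in>{0..}. h g t)" for g
  \<comment> \<open>Subadditivity on \<open>t f = (g + t f) + (- g)\<close> bounds the infimum from
    below; without such a bound a real infimum carries no information.\<close>
  have lower: "- q (\<lambda>z. - g z) \<le> h g t" if "g \<in> V" "t \<ge> 0" for g t
  proof -
    have "q (\<lambda>z. (g z + t * f z) + - g z) \<le> q (\<lambda>z. g z + t * f z) + q (\<lambda>z. - g z)"
      using that by (intro sublinear_add q uminus add scale f)
    moreover have "(\<lambda>z. (g z + t * f z) + - g z) = (\<lambda>z. t * f z)" by simp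
    ultimately show ?thesis
      using sublinear_scale[OF q f that(2)] by (simp add: h_def)
  qed
  have bdd: "bdd_below (h g ` {0..})" if "g \<in> V" for g
    using lower[OF that] by (intro bdd_belowI2[where m = "- q (\<lambda>z. - g z)"]) auto
  have le: "q' g \<le> h g t" if "g \<in> V" "t \<ge> 0" for g t
    unfolding q'_def using bdd[OF that(1)] that(2) by (intro cINF_lower) auto
  have "q' (\<lambda>z. g1 z + g2 z) \<le> q' g1 + q' g2" if g: "g1 \<in> V" "g2 \<in> V" for g1 g2
  proof -
    have *: "q' (\<lambda>z. g1 z + g2 z) \<le> h g1 s + h g2 t" if "s \<ge> 0" "t \<ge> 0" for s t
    proof -
      have "q' (\<lambda>z. g1 z + g2 z) \<le> h (\<lambda>z. g1 z + g2 z) (s + t)"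
        using that g by (intro le add) auto
      also have "(\<lambda>z. g1 z + g2 z + (s + t) * f z) = (\<lambda>z. (g1 z + s * f z) + (g2 z + t * f z))"
        by (auto simp: algebra_simps)
      then have "h (\<lambda>z. g1 z + g2 z) (s + t) \<le> h g1 s + h g2 t"
        using sublinear_add[OF q, of "\<lambda>z. g1 z + s * f z" "\<lambda>z. g2 z + t * f z"] g f
        by (simp add: h_def add scale algebra_simps)
      finally show ?thesis .
    qed
    have "q' (\<lambda>z. g1 z + g2 z) - h g1 s \<le> q' g2" if "s \<ge> 0" for s
      unfolding q'_def[of g2] using *[OF that] by (intro cINF_greatest) (auto simp: algebra_simps)
    then have "q' (\<lambda>z. g1 z + g2 z) - q' g2 \<le> q' g1"
      unfolding q'_def[of g1] by (intro cINF_greatest) (auto simp: algebra_simps)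
    then show ?thesis by simp
  qed
  moreover have "q' (\<lambda>z. r * g z) \<le> r * q' g" if g: "g \<in> V" and r: "r > 0" for g r
  proof -
    have "q' (\<lambda>z. r * g z) / r \<le> h g t" if "t \<ge> 0" for t
    proof -
      have "q' (\<lambda>z. r * g z) \<le> h (\<lambda>z. r * g z) (r * t)"
        using that g r by (intro le scale) auto
      also have "(\<lambda>z. r * g z + r * t * f z) = (\<lambda>z. r * (g z + t * f z))"
        by (auto simp: algebra_simps)
      then have "h (\<lambda>z. r * g z) (r * t) = r * h g t"
        using sublinear_scale[OF q, of "\<lambda>z. g z + t * f z" r] g f r
        by (simp add: h_def add scale algebra_simps)
      finally show ?thesis using r by (simp add: field_simps)
    qed
    then have "q' (\<lambda>z. r * g z) / r \<le> q' g"
      unfolding q'_def[of g] by (intro cINF_greatest) auto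
    then show ?thesis using r by (simp add: field_simps)
  qed
  ultimately have "sublinear q'" by (auto simp: sublinear_def)
  \<comment> \<open>\<open>t = 0\<close> gives \<open>q' \<le> q\<close>; at \<open>- f\<close>, the
    choice \<open>t = 1\<close> leaves \<open>q 0 - q f\<close>.\<close>
  moreover have "q' g \<le> q g" if "g \<in> V" for g
    using le[OF that, of 0] by (simp add: h_def)
  moreover have "q' (\<lambda>z. - f z) \<le> - q f"
    using le[OF uminus[OF f], of 1] sublinear_zero[OF q] by (simp add: h_def)
  ultimately show thesis by (rule that)
qed

text \<open>Zorn's lemma gives a minimal sublinear functional below \<open>p\<close>;
  \<open>sublinear_descent\<close> makes it odd, and an odd sublinear functional is linear.\<close>

lemma hahn_banach:
  assumes p: "sublinear p"
  obtains L where "\<And>f g. f \<in> V \<Longrightarrow> g \<in> V \<Longrightarrow> L (\<lambda>z. f z + g z) = L f + L g"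
    and "\<And>f r. f \<in> V \<Longrightarrow> L (\<lambda>z. r * f z) = r * L f"
    and "\<And>f. f \<in> V \<Longrightarrow> L f \<le> p f"
proof -
  \<comment> \<open>Values off \<open>V\<close> are pinned to \<open>0\<close>, so that comparing
    functionals on all functions, as \<open>P\<close> does, only compares them on
    \<open>V\<close>.\<close>
  define A where "A = {q. sublinear q \<and> (\<forall>f\<in>V. q f \<le> p f) \<and> (\<forall>f. f \<notin> V \<longrightarrow> q f = 0)}"
  \<comment> \<open>The order is reversed because \<open>predicate_Zorn\<close> yields a maximal
    element.\<close>
  define P where "P q q' \<longleftrightarrow> (\<forall>f. q' f \<le> q f)" for q q' :: "('z \<Rightarrow> real) \<Rightarrow> real"
  define restr where "restr q f = (if f \<in> V then q f else 0)" for q :: "('z \<Rightarrow> real) \<Rightarrow> real" and f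
  have restr: "restr q \<in> A" if "sublinear q" "\<And>f. f \<in> V \<Longrightarrow> q f \<le> p f" for q
    using that by (auto simp: A_def restr_def sublinear_def add scale)
  have "\<exists>m\<in>A. \<forall>a\<in>A. P m a \<longrightarrow> a = m"
  proof (rule predicate_Zorn)
    show "partial_order_on A (relation_of P A)"
      by (rule partial_order_on_relation_ofI) (auto simp: P_def fun_eq_iff intro: order_trans antisym)
  next
    fix C assume C: "C \<in> Chains (relation_of P A)"
    then have CA: "C \<subseteq> A" and chain: "\<And>q q'. q \<in> C \<Longrightarrow> q' \<in> C \<Longrightarrow> P q q' \<or> P q' q"
      by (auto simp: Chains_def relation_of_def)
    show "\<exists>u\<in>A. \<forall>a\<in>C. P a u"
    proof (cases "C = {}")
      case True
      then show ?thesis using restr[OF p] by auto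
    next
      case False
      define u where "u f = (INF q\<in>C. q f)" for f
      \<comment> \<open>Each \<open>q\<close> in \<open>A\<close> satisfies
        \<open>- p (- f) \<le> - q (- f) \<le> q f\<close>, so the infimum of the chain is
        finite.\<close>
      have bdd: "bdd_below ((\<lambda>q. q f) ` C)" if "f \<in> V" for f
      proof (rule bdd_belowI2)
        fix q assume "q \<in> C"
        then have "sublinear q" "q (\<lambda>z. - f z) \<le> p (\<lambda>z. - f z)"
          using CA uminus[OF that] by (auto simp: A_def)
        then show "- p (\<lambda>z. - f z) \<le> q f"
          using sublinear_uminus[OF _ that, of q] by simp
      qed
      have le: "u f \<le> q f" if "f \<in> V" "q \<in> C" for f q
        unfolding u_def using bdd that by (intro cINF_lower) auto
      have "u (\<lambda>z. f z + g z) \<le> u f + u g" if fg: "f \<in> V" "g \<in> V" for f g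
      proof -
        have *: "u (\<lambda>z. f z + g z) \<le> q f + q' g" if q: "q \<in> C" "q' \<in> C" for q q'
        proof -
          \<comment> \<open>In a chain one of \<open>q\<close> and \<open>q'\<close> lies below the
            other, hence at \<open>f\<close> and at \<open>g\<close> simultaneously.\<close>
          obtain r where r: "r \<in> C" "r f \<le> q f" "r g \<le> q' g"
            using chain[OF q] q unfolding P_def by (metis order_refl)
          have "u (\<lambda>z. f z + g z) \<le> r (\<lambda>z. f z + g z)"
            using le add fg r by blast
          also have "\<dots> \<le> r f + r g"
            using r CA fg by (intro sublinear_add) (auto simp: A_def)
          finally show ?thesis using r by simp
        qed
        have "u (\<lambda>z. f z + g z) - q f \<le> u g" if "q \<in> C" for q
          unfolding u_def[of g] using *[OF that] False
          by (intro cINF_greatest) (auto simp: algebra_simps)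
        then have "u (\<lambda>z. f z + g z) - u g \<le> u f"
          unfolding u_def[of f] using False by (intro cINF_greatest) (auto simp: algebra_simps)
        then show ?thesis by simp
      qed
      moreover have "u (\<lambda>z. r * f z) \<le> r * u f" if f: "f \<in> V" and r: "r > 0" for f r
      proof -
        have "u (\<lambda>z. r * f z) / r \<le> q f" if "q \<in> C" for q
          using le[OF scale[OF f] that, of r] sublinear_scale[of q f r] that CA f r
          by (auto simp: A_def field_simps)
        then have "u (\<lambda>z. r * f z) / r \<le> u f"
          unfolding u_def[of f] using False by (intro cINF_greatest) auto
        then show ?thesis using r by (simp add: field_simps)
      qed
      ultimately have "sublinear u" by (auto simp: sublinear_def)
      moreover have "u f \<le> p f" if "f \<in> V" for f
      proof -
        obtain q where "q \<in> C" using False by blast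
        then show ?thesis using le[OF that \<open>q \<in> C\<close>] CA that by (force simp: A_def)
      qed
      ultimately have "restr u \<in> A" by (rule restr)
      moreover have "P q (restr u)" if "q \<in> C" for q
        using le that CA by (auto simp: P_def restr_def A_def)
      ultimately show ?thesis by blast
    qed
  qed
  then obtain L where L: "L \<in> A" and min: "\<And>q. q \<in> A \<Longrightarrow> P L q \<Longrightarrow> q = L" by blast
  then have sub: "sublinear L" and Lp: "\<And>f. f \<in> V \<Longrightarrow> L f \<le> p f" by (auto simp: A_def)
  have odd: "L (\<lambda>z. - f z) = - L f" if f: "f \<in> V" for f
  proof -
    obtain q where q: "sublinear q" "\<And>g. g \<in> V \<Longrightarrow> q g \<le> L g" "q (\<lambda>z. - f z) \<le> - L f"
      using sublinear_descent[OF sub f] by blast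
    have "restr q \<in> A"
      using q Lp by (intro restr) (auto intro: order_trans)
    moreover have "P L (restr q)"
      using q L by (auto simp: P_def restr_def A_def)
    ultimately have "restr q = L" by (rule min)
    then have "L (\<lambda>z. - f z) = q (\<lambda>z. - f z)"
      using uminus[OF f] by (auto simp: restr_def)
    then show ?thesis using q(3) sublinear_uminus[OF sub f] by simp
  qed
  show thesis
  proof
    \<comment> \<open>The reverse inequality is subadditivity on \<open>f = (f + g) + (- g)\<close>
      combined with oddness.\<close>
    show "L (\<lambda>z. f z + g z) = L f + L g" if "f \<in> V" "g \<in> V" for f g
      using sublinear_add[OF sub that] odd[OF that(2)]
        sublinear_add[OF sub add[OF that] uminus[OF that(2)]] by simp
    show "L (\<lambda>z. r * f z) = r * L f" if "f \<in> V" for f r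
    proof (cases "r \<ge> 0")
      case True
      then show ?thesis using sublinear_scale[OF sub that] by simp
    next
      case False
      then show ?thesis
        using sublinear_scale[OF sub uminus[OF that], of "- r"] odd[OF that] by simp
    qed
  qed (rule Lp)
qed

text \<open>\<open>S f\<close> collects the values of a minimisation problem attached to
  \<open>f\<close>, and its infimum is the sublinear functional. It is bounded below because adding
  an element of \<open>S (- f)\<close> lands in \<open>S 0\<close>, where \<open>S_zero\<close>
  applies.\<close>

lemma hahn_banach_cone:
  fixes S :: "('z \<Rightarrow> real) \<Rightarrow> real set"
  assumes nonempty: "\<And>f. f \<in> V \<Longrightarrow> S f \<noteq> {}"
    and S_add: "\<And>f g s t. f \<in> V \<Longrightarrow> g \<in> V \<Longrightarrow> s \<in> S f \<Longrightarrow> t \<in> S g \<Longrightarrow> s + t \<in> S (\<lambda>z. f z + g z)"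
    and S_scale: "\<And>f r s. f \<in> V \<Longrightarrow> r > 0 \<Longrightarrow> s \<in> S f \<Longrightarrow> r * s \<in> S (\<lambda>z. r * f z)"
    and S_zero: "\<And>s. s \<in> S (\<lambda>_. 0) \<Longrightarrow> 0 \<le> s"
  obtains L where "\<And>f g. f \<in> V \<Longrightarrow> g \<in> V \<Longrightarrow> L (\<lambda>z. f z + g z) = L f + L g"
    and "\<And>f r. f \<in> V \<Longrightarrow> L (\<lambda>z. r * f z) = r * L f"
    and "\<And>f s. f \<in> V \<Longrightarrow> s \<in> S f \<Longrightarrow> L f \<le> s"
proof -
  have bdd: "bdd_below (S f)" if f: "f \<in> V" for f
  proof -
    obtain t where t: "t \<in> S (\<lambda>z. - f z)" using nonempty[OF uminus[OF f]] by blast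
    have "- t \<le> s" if "s \<in> S f" for s
      using S_zero[of "s + t"] S_add[OF f uminus[OF f] that t] by simp
    then show ?thesis by (rule bdd_belowI)
  qed
  have le: "Inf (S f) \<le> s" if "f \<in> V" "s \<in> S f" for f s
    using bdd that by (intro cInf_lower) auto
  have "sublinear (\<lambda>f. Inf (S f))"
    unfolding sublinear_def
  proof safe
    fix f g assume fg: "f \<in> V" "g \<in> V"
    have *: "Inf (S (\<lambda>z. f z + g z)) \<le> s + t" if "s \<in> S f" "t \<in> S g" for s t
      using fg that by (intro le add S_add) auto
    have "Inf (S (\<lambda>z. f z + g z)) - s \<le> Inf (S g)" if "s \<in> S f" for s
      using *[OF that] nonempty fg by (intro cInf_greatest) (auto simp: algebra_simps)
    then have "Inf (S (\<lambda>z. f z + g z)) - Inf (S g) \<le> Inf (S f)"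
      using nonempty fg by (intro cInf_greatest) (auto simp: algebra_simps)
    then show "Inf (S (\<lambda>z. f z + g z)) \<le> Inf (S f) + Inf (S g)" by simp
  next
    fix f :: "'z \<Rightarrow> real" and r :: real assume f: "f \<in> V" and r: "r > 0"
    have "Inf (S (\<lambda>z. r * f z)) / r \<le> s" if "s \<in> S f" for s
      using le[OF scale[OF f] S_scale[OF f r that]] r by (simp add: field_simps)
    then have "Inf (S (\<lambda>z. r * f z)) / r \<le> Inf (S f)"
      using nonempty f by (intro cInf_greatest) auto
    then show "Inf (S (\<lambda>z. r * f z)) \<le> r * Inf (S f)" using r by (simp add: field_simps)
  qed
  then show thesis
    by (rule hahn_banach) (use that le in \<open>blast intro: order_trans\<close>)
qed

end

section \<open>Extension of a content with compact inner regular marginals\<close>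

text \<open>The error is measured on \<open>A - K\<close>, the form that carries over to a finitely
  additive content.\<close>

definition compact_inner_regular :: "'a::topological_space measure \<Rightarrow> bool" where
  "compact_inner_regular \<mu> \<longleftrightarrow>
     (\<forall>A\<in>sets borel. \<forall>e>0. \<exists>K\<subseteq>A. compact K \<and> measure \<mu> (A - K) \<le> e)"

text \<open>All subsets are measured, since the content in view comes from a functional on all
  bounded functions.\<close>

locale content =
  fixes m :: "'z set \<Rightarrow> real"
  assumes nonneg: "0 \<le> m E"
    and additive: "E \<inter> F = {} \<Longrightarrow> m (E \<union> F) = m E + m F"
begin

lemma empty: "m {} = 0"
  using additive[of "{}" "{}"] by simp

lemma mono: "E \<subseteq> F \<Longrightarrow> m E \<le> m F"
  using additive[of E "F - E"] nonneg[of "F - E"] by (simp add: Un_absorb1)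

lemma subadditive: "m (E \<union> F) \<le> m E + m F"
  using additive[of E "F - E"] mono[of "F - E" F] by auto

lemma le_subadditive: "E \<subseteq> F \<union> G \<Longrightarrow> m E \<le> m F + m G"
  using mono subadditive order_trans by blast

lemma UN_subadditive: "finite I \<Longrightarrow> m (\<Union>i\<in>I. E i) \<le> (\<Sum>i\<in>I. m (E i))"
proof (induction I rule: finite_induct)
  case (insert i I)
  then show ?case using subadditive[of "E i" "\<Union>i\<in>I. E i"] by simp
qed (simp add: empty)

end

locale topological_content = content m for m :: "'z::t2_space set \<Rightarrow> real"
begin

definition inner_approx :: "'z set \<Rightarrow> bool" where
  "inner_approx E \<longleftrightarrow> (\<forall>e>0. \<exists>K\<subseteq>E. compact K \<and> m (E - K) \<le> e)"

lemma inner_approx_empty: "inner_approx {}"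
  by (auto simp: inner_approx_def empty)

lemma inner_approx_Un:
  assumes "inner_approx E" "inner_approx F"
  shows "inner_approx (E \<union> F)"
  unfolding inner_approx_def
proof (intro allI impI)
  fix e :: real assume "e > 0"
  then obtain K J where K: "K \<subseteq> E" "compact K" "m (E - K) \<le> e/2"
    and J: "J \<subseteq> F" "compact J" "m (F - J) \<le> e/2"
    using assms unfolding inner_approx_def by (metis half_gt_zero)
  moreover have "m (E \<union> F - (K \<union> J)) \<le> m (E - K) + m (F - J)"
    by (rule le_subadditive) auto
  ultimately show "\<exists>C\<subseteq>E \<union> F. compact C \<and> m (E \<union> F - C) \<le> e"
    by (intro exI[of _ "K \<union> J"]) auto
qed

lemma inner_approx_Int:
  assumes "inner_approx E" "inner_approx F"
  shows "inner_approx (E \<inter> F)"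
  unfolding inner_approx_def
proof (intro allI impI)
  fix e :: real assume "e > 0"
  then obtain K J where K: "K \<subseteq> E" "compact K" "m (E - K) \<le> e/2"
    and J: "J \<subseteq> F" "compact J" "m (F - J) \<le> e/2"
    using assms unfolding inner_approx_def by (metis half_gt_zero)
  moreover have "m (E \<inter> F - (K \<inter> J)) \<le> m (E - K) + m (F - J)"
    by (rule le_subadditive) auto
  ultimately show "\<exists>C\<subseteq>E \<inter> F. compact C \<and> m (E \<inter> F - C) \<le> e"
    by (intro exI[of _ "K \<inter> J"]) (auto intro: compact_Int)
qed

text \<open>Inner approximation need not pass to complements, so it is demanded of both sides. Borel
  measurability keeps the generated sigma algebra inside the Borel sets.\<close>

definition approx_algebra :: "'z set set" where
  "approx_algebra = {E \<in> sets borel. inner_approx E \<and> inner_approx (- E)}"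

lemma algebra_approx_algebra:
  assumes "inner_approx UNIV"
  shows "algebra UNIV approx_algebra"
  unfolding algebra_iff_Un approx_algebra_def
  using assms inner_approx_empty
  by (auto simp: Compl_eq_Diff_UNIV[symmetric] intro!: inner_approx_Un inner_approx_Int)

text \<open>If \<open>E n\<close> decreases to the empty set, choose compact \<open>K n \<subseteq> E n\<close> losing at most
  \<open>e / 2 ^ (n + 2)\<close>.  Finitely many \<open>K n\<close> already have empty intersection.\<close>

lemma approx_algebra_continuous:
  assumes E: "range E \<subseteq> approx_algebra" "decseq E" "(\<Inter>i. E i) = {}"
  shows "(\<lambda>i. m (E i)) \<longlonglongrightarrow> 0"
proof (rule LIMSEQ_I)
  fix e :: real assume e: "e > 0"
  have "\<forall>i. \<exists>K. K \<subseteq> E i \<and> compact K \<and> m (E i - K) \<le> e/4 * (1/2)^i"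
  proof
    fix i
    have "inner_approx (E i)" using E(1) by (auto simp: approx_algebra_def)
    moreover have "e/4 * (1/2)^i > 0" using e by simp
    ultimately show "\<exists>K. K \<subseteq> E i \<and> compact K \<and> m (E i - K) \<le> e/4 * (1/2)^i"
      by (simp only: inner_approx_def)
  qed
  from choice[OF this] obtain K where K: "\<And>i. K i \<subseteq> E i" "\<And>i. compact (K i)"
    "\<And>i. m (E i - K i) \<le> e/4 * (1/2)^i"
    by blast
  have "\<exists>I. finite I \<and> K 0 \<inter> (\<Inter>i\<in>I. K i) = {}"
  proof (rule ccontr)
    assume no: "\<not> ?thesis"
    have "K 0 \<inter> (\<Inter>i\<in>UNIV. K i) \<noteq> {}"
    proof (rule compact_imp_fip_image)
      show "closed (K i)" for i using K(2) by (rule compact_imp_closed)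
      show "K 0 \<inter> (\<Inter>i\<in>I. K i) \<noteq> {}" if "finite I" for I using no that by blast
    qed (rule K(2))
    moreover have "(\<Inter>i. K i) \<subseteq> (\<Inter>i. E i)" using K(1) by (intro INF_mono) auto
    ultimately show False using E(3) by auto
  qed
  then obtain I where I: "finite I" "K 0 \<inter> (\<Inter>i\<in>I. K i) = {}" by blast
  have "m (E n) < e" if n: "n \<ge> Max (insert 0 I)" for n
  proof -
    \<comment> \<open>A point of \<open>E n\<close> lies in every \<open>E i\<close> with
      \<open>i \<le> n\<close> but misses one of the chosen \<open>K i\<close>.\<close>
    have "E n \<subseteq> (\<Union>i\<in>{..n}. E i - K i)"
    proof
      fix z assume z: "z \<in> E n"
      obtain i where i: "i \<in> insert 0 I" "z \<notin> K i" using I(2) by blast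
      then have "i \<le> n" using n I(1) by auto
      then show "z \<in> (\<Union>i\<in>{..n}. E i - K i)"
        using z i decseqD[OF E(2)] by blast
    qed
    then have "m (E n) \<le> m (\<Union>i\<in>{..n}. E i - K i)" by (rule mono)
    also have "\<dots> \<le> (\<Sum>i\<le>n. m (E i - K i))" by (rule UN_subadditive) simp
    also have "\<dots> \<le> (\<Sum>i\<le>n. e/4 * (1/2)^i)" by (intro sum_mono K)
    also have "\<dots> = e/4 * (2 - (1/2)^n)"
      unfolding sum_distrib_left[symmetric] by (induction n) (auto simp: field_simps)
    also have "\<dots> \<le> e/4 * 2" using e by (intro mult_left_mono) auto
    finally show ?thesis using e by simp
  qed
  then show "\<exists>no. \<forall>n\<ge>no. norm (m (E n) - 0) < e" using nonneg by auto
qed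

text \<open>Continuity at the empty set makes the content a premeasure on the algebra, and
  Caratheodory's theorem extends it. Agreement with \<open>m\<close> is claimed on the algebra
  only.\<close>

lemma approx_algebra_extension:
  assumes UNIV: "inner_approx UNIV"
    and gen: "sets borel \<subseteq> sigma_sets UNIV approx_algebra"
  obtains \<gamma> where "\<gamma> \<in> finite_borel_measures"
    and "\<And>E. E \<in> approx_algebra \<Longrightarrow> emeasure \<gamma> E = ennreal (m E)"
proof -
  interpret algebra UNIV approx_algebra by (rule algebra_approx_algebra[OF UNIV])
  have "sigma_sets UNIV approx_algebra \<subseteq> sets borel"
    using sets.sigma_sets_subset[of approx_algebra borel] by (auto simp: approx_algebra_def)
  with gen have sigma: "sigma_sets UNIV approx_algebra = sets borel" by blast
  have "\<exists>\<mu>'. (\<forall>s\<in>approx_algebra. \<mu>' s = ennreal (m s)) \<and>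
      measure_space UNIV (sigma_sets UNIV approx_algebra) \<mu>'"
  proof (rule caratheodory_empty_continuous)
    show "positive approx_algebra (\<lambda>E. ennreal (m E))"
      by (simp add: positive_def empty)
    show "Measure_Space.additive approx_algebra (\<lambda>E. ennreal (m E))"
      by (simp add: Measure_Space.additive_def additive nonneg ennreal_plus)
    show "(\<lambda>i. ennreal (m (A i))) \<longlonglongrightarrow> 0"
      if "range A \<subseteq> approx_algebra" "decseq A" "(\<Inter>i. A i) = {}" for A
      using tendsto_ennrealI[OF approx_algebra_continuous[OF that]] by simp
  qed simp
  then obtain \<mu>' where \<mu>': "\<And>E. E \<in> approx_algebra \<Longrightarrow> \<mu>' E = ennreal (m E)"
    and ms: "sigma_algebra UNIV (sets (borel :: 'z measure))"
      "positive (sets (borel :: 'z measure)) \<mu>'" "countably_additive (sets (borel :: 'z measure)) \<mu>'"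
    unfolding sigma measure_space_def by blast
  define \<gamma> where "\<gamma> = measure_of UNIV (sets (borel :: 'z measure)) \<mu>'"
  have sets: "sets \<gamma> = sets borel"
    unfolding \<gamma>_def using ms(1) by (simp add: sigma_algebra.sigma_sets_eq)
  have space: "space \<gamma> = UNIV" using sets_eq_imp_space_eq[OF sets] by simp
  have \<gamma>: "emeasure \<gamma> E = ennreal (m E)" if "E \<in> approx_algebra" for E
    using emeasure_measure_of_sigma[OF ms, of E] \<mu>'[OF that] that
    by (simp add: \<gamma>_def approx_algebra_def)
  moreover have "finite_measure \<gamma>"
    using \<gamma>[OF top] by (intro finite_measureI) (simp add: space)
  ultimately show thesis using sets by (intro that[of \<gamma>]) (auto simp: finite_borel_measures_def)
qed

end

text \<open>Products of compact sets approximate rectangles from inside, the loss being controlled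
  by the marginals. \<open>\<R>\<close> is handed out so that step functions over it integrate alike
  against \<open>\<gamma>\<close> and \<open>m\<close>.\<close>

lemma coupling_of_content:
  fixes \<mu> \<nu> :: "'a::{second_countable_topology, t2_space} measure"
  assumes "content m"
    and \<mu>: "\<mu> \<in> finite_borel_measures" "compact_inner_regular \<mu>"
    and \<nu>: "\<nu> \<in> finite_borel_measures" "compact_inner_regular \<nu>"
    and marg1: "\<And>A. A \<in> sets borel \<Longrightarrow> m (A \<times> UNIV) = measure \<mu> A"
    and marg2: "\<And>A. A \<in> sets borel \<Longrightarrow> m (UNIV \<times> A) = measure \<nu> A"
  obtains \<gamma> \<R> where "\<gamma> \<in> couplings \<mu> \<nu>" and "algebra UNIV \<R>" and "\<R> \<subseteq> sets borel"
    and "\<And>A B. A \<in> sets borel \<Longrightarrow> B \<in> sets borel \<Longrightarrow> A \<times> B \<in> \<R>"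
    and "\<And>E. E \<in> \<R> \<Longrightarrow> emeasure \<gamma> E = ennreal (m E)"
proof -
  interpret content m by fact
  interpret topological_content m ..
  have rect: "inner_approx (A \<times> B)" if A: "A \<in> sets borel" and B: "B \<in> sets borel" for A B
    unfolding inner_approx_def
  proof (intro allI impI)
    fix e :: real assume "e > 0"
    then obtain K J where K: "K \<subseteq> A" "compact K" "measure \<mu> (A - K) \<le> e/2"
      and J: "J \<subseteq> B" "compact J" "measure \<nu> (B - J) \<le> e/2"
      using \<mu>(2) \<nu>(2) A B unfolding compact_inner_regular_def by (meson half_gt_zero)
    \<comment> \<open>A point of \<open>A \<times> B\<close> outside \<open>K \<times> J\<close>
      lies in one of two strips, whose contents are marginal masses.\<close>
    have "m (A \<times> B - K \<times> J) \<le> m ((A - K) \<times> UNIV) + m (UNIV \<times> (B - J))"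
      by (rule le_subadditive) auto
    also have "\<dots> = measure \<mu> (A - K) + measure \<nu> (B - J)"
      using A B K J by (simp add: marg1 marg2 sets.Diff borel_compact)
    finally show "\<exists>C\<subseteq>A \<times> B. compact C \<and> m (A \<times> B - C) \<le> e"
      using K J by (intro exI[of _ "K \<times> J"]) (auto intro: compact_Times)
  qed
  have rect_alg: "A \<times> B \<in> approx_algebra" if A: "A \<in> sets borel" and B: "B \<in> sets borel" for A B
  proof -
    \<comment> \<open>The complement of a rectangle is a union of two rectangles, so
      \<open>rect\<close> covers it too.\<close>
    have "- (A \<times> B) = (- A) \<times> UNIV \<union> UNIV \<times> (- B)" by auto
    moreover have "inner_approx \<dots>"
      using A B by (intro inner_approx_Un rect) auto
    moreover have "A \<times> B \<in> sets borel"
      using pair_measureI[OF A B] by (simp only: borel_prod)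
    ultimately show ?thesis
      using rect[OF A B] by (simp add: approx_algebra_def)
  qed
  \<comment> \<open>Second countability identifies the Borel sets of the product with the product
    sigma algebra.\<close>
  have "sets (borel :: ('a \<times> 'a) measure) = sigma_sets UNIV {A \<times> B | A B. A \<in> sets borel \<and> B \<in> sets borel}"
    unfolding borel_prod[symmetric] sets_pair_measure by simp
  also have "\<dots> \<subseteq> sigma_sets UNIV approx_algebra"
    by (rule sigma_sets_mono') (auto intro: rect_alg)
  finally have gen: "sets (borel :: ('a \<times> 'a) measure) \<subseteq> sigma_sets UNIV approx_algebra" .
  have UNIV: "inner_approx UNIV" using rect[of UNIV UNIV] by simp
  obtain \<gamma> where \<gamma>: "\<gamma> \<in> finite_borel_measures"
    "\<And>E. E \<in> approx_algebra \<Longrightarrow> emeasure \<gamma> E = ennreal (m E)"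
    using approx_algebra_extension[OF UNIV gen] by blast
  interpret \<mu>: finite_measure \<mu> using \<mu>(1) by (simp add: finite_borel_measures_def)
  interpret \<nu>: finite_measure \<nu> using \<nu>(1) by (simp add: finite_borel_measures_def)
  show thesis
  proof (rule that)
    show "\<gamma> \<in> couplings \<mu> \<nu>"
      unfolding couplings_def
    proof (intro CollectI conjI ballI)
      show "\<gamma> \<in> finite_borel_measures" by fact
      fix A :: "'a set" assume A: "A \<in> sets borel"
      show "emeasure \<gamma> (A \<times> UNIV) = emeasure \<mu> A"
        using A by (simp add: \<gamma>(2) rect_alg marg1 \<mu>.emeasure_eq_measure)
      show "emeasure \<gamma> (UNIV \<times> A) = emeasure \<nu> A"
        using A by (simp add: \<gamma>(2) rect_alg marg2 \<nu>.emeasure_eq_measure)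
    qed
    show "algebra UNIV approx_algebra" using UNIV by (rule algebra_approx_algebra)
    show "approx_algebra \<subseteq> sets borel" by (auto simp: approx_algebra_def)
  qed (rule rect_alg \<gamma>(2), assumption+)+
qed

section \<open>Kantorovich duality for lower semicontinuous costs\<close>

text \<open>Superlevel sets at rational heights are open, hence unions of rectangles from countable
  bases, so countably many pairs of a height and a rectangle suffice.\<close>

lemma lower_semicontinuous_SUP_rectangles:
  fixes c :: "'a::second_countable_topology \<times> 'b::second_countable_topology \<Rightarrow> ennreal"
  assumes c: "lower_semicontinuous c"
  obtains r :: "nat \<Rightarrow> real" and U :: "nat \<Rightarrow> 'a set" and V :: "nat \<Rightarrow> 'b set"
  where "\<And>k. open (U k)" and "\<And>k. open (V k)"
    and "\<And>k z. z \<in> U k \<times> V k \<Longrightarrow> ennreal (r k) \<le> c z"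
    and "\<And>z t. t < c z \<Longrightarrow> \<exists>k. z \<in> U k \<times> V k \<and> t \<le> ennreal (r k)"
proof -
  obtain A :: "'a set set" where A: "countable A" "topological_basis A"
    using ex_countable_basis by blast
  obtain B :: "'b set set" where B: "countable B" "topological_basis B"
    using ex_countable_basis by blast
  \<comment> \<open>The empty set is added so that \<open>T\<close> is visibly nonempty and
    \<open>from_nat_into\<close> enumerates it.\<close>
  define T where "T = {(q, U, V). q \<in> \<rat> \<and> U \<in> insert {} A \<and> V \<in> insert {} B \<and>
    (\<forall>z\<in>U \<times> V. ennreal q \<le> c z)}"
  have "T \<subseteq> \<rat> \<times> insert {} A \<times> insert {} B" by (auto simp: T_def)
  then have "countable T"
    by (rule countable_subset) (intro countable_SIGMA countable_rat countable_insert A B)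
  moreover have "(0, {}, {}) \<in> T" by (simp add: T_def)
  ultimately have f: "range (from_nat_into T) = T"
    by (intro range_from_nat_into) auto
  define f where "f = from_nat_into T"
  define r where "r k = fst (f k)" for k
  define U where "U k = fst (snd (f k))" for k
  define V where "V k = snd (snd (f k))" for k
  have mem: "(r k, U k, V k) \<in> T" for k
    using f unfolding f_def[symmetric] by (auto simp: r_def U_def V_def)
  have ex: "\<exists>k. r k = q \<and> U k = X \<and> V k = Y" if "(q, X, Y) \<in> T" for q X Y
  proof -
    have "(q, X, Y) \<in> range f" using that f by (simp add: f_def)
    then obtain k where "f k = (q, X, Y)" by (metis imageE)
    then show ?thesis by (intro exI[of _ k]) (simp add: r_def U_def V_def)
  qed
  show thesis
  proof
    show "open (U k)" "open (V k)" for k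
      using mem[of k] topological_basis_open[OF A(2)] topological_basis_open[OF B(2)]
      by (auto simp: T_def)
    show "ennreal (r k) \<le> c z" if "z \<in> U k \<times> V k" for k z
      using mem[of k] that unfolding T_def by blast
    show "\<exists>k. z \<in> U k \<times> V k \<and> t \<le> ennreal (r k)" if t: "t < c z" for z t
    proof -
      obtain q where q: "t < ennreal (real_of_rat q)" "ennreal (real_of_rat q) < c z"
        using ennreal_rat_dense[OF t] by blast
      have "open {z. ennreal (real_of_rat q) < c z}"
        using c by (simp add: lower_semicontinuous_def)
      then obtain X Y where XY: "open X" "open Y" "z \<in> X \<times> Y"
        "X \<times> Y \<subseteq> {z. ennreal (real_of_rat q) < c z}"
        using q(2) by (auto elim: open_prod_elim)
      obtain X' where X': "X' \<in> A" "fst z \<in> X'" "X' \<subseteq> X"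
        using topological_basisE[OF A(2) XY(1), of "fst z"] XY(3) by (metis mem_Times_iff)
      obtain Y' where Y': "Y' \<in> B" "snd z \<in> Y'" "Y' \<subseteq> Y"
        using topological_basisE[OF B(2) XY(2), of "snd z"] XY(3) by (metis mem_Times_iff)
      have "ennreal (real_of_rat q) \<le> c w" if "w \<in> X' \<times> Y'" for w
      proof -
        have "w \<in> X \<times> Y" using that X' Y' by auto
        then show ?thesis using XY(4) by (auto intro: less_imp_le)
      qed
      then have "(real_of_rat q, X', Y') \<in> T"
        using X' Y' by (auto simp: T_def)
      then obtain k where "r k = real_of_rat q" "U k = X'" "V k = Y'" using ex by blast
      then show ?thesis
        using q(1) X' Y' by (intro exI[of _ k]) (simp add: mem_Times_iff less_imp_le)
    qed
  qed
qed

text \<open>The approximants are running maxima of steps over rectangles. Their level sets are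
  finite Boolean combinations of rectangles, so a finitely additive set function can integrate
  them.\<close>

lemma lower_semicontinuous_step_approx:
  fixes c :: "'a::second_countable_topology \<times> 'b::second_countable_topology \<Rightarrow> ennreal"
  assumes c: "lower_semicontinuous c" and alg: "algebra UNIV \<R>"
    and rect: "\<And>U V. open U \<Longrightarrow> open V \<Longrightarrow> U \<times> V \<in> \<R>"
  obtains s :: "nat \<Rightarrow> 'a \<times> 'b \<Rightarrow> real"
  where "\<And>n z. 0 \<le> s n z" and "\<And>n. finite (range (s n))" and "\<And>n v. s n -` {v} \<in> \<R>"
    and "\<And>z. incseq (\<lambda>n. s n z)" and "\<And>z. c z = (SUP n. ennreal (s n z))"
proof -
  interpret algebra UNIV \<R> by (rule alg)
  obtain r :: "nat \<Rightarrow> real" and U :: "nat \<Rightarrow> 'a set" and V :: "nat \<Rightarrow> 'b set"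
    where U: "\<And>k. open (U k)" and V: "\<And>k. open (V k)"
    and le: "\<And>k z. z \<in> U k \<times> V k \<Longrightarrow> ennreal (r k) \<le> c z"
    and ex: "\<And>z t. t < c z \<Longrightarrow> \<exists>k. z \<in> U k \<times> V k \<and> t \<le> ennreal (r k)"
    by (rule lower_semicontinuous_SUP_rectangles[OF c]) (rule that)
  \<comment> \<open>Starting from \<open>0\<close> keeps every approximant nonnegative, even where
    \<open>r n\<close> is negative.\<close>
  define s where "s = rec_nat (\<lambda>_. 0) (\<lambda>n f z. if z \<in> U n \<times> V n then max (f z) (r n) else f z)"
  have s0: "s 0 = (\<lambda>_. 0)"
    and sSuc: "\<And>n. s (Suc n) = (\<lambda>z. if z \<in> U n \<times> V n then max (s n z) (r n) else s n z)"
    by (auto simp: s_def)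
  have fin: "finite (range (s n))" for n
  proof (induction n)
    case (Suc n)
    have "range (s (Suc n)) \<subseteq> range (s n) \<union> (\<lambda>v. max v (r n)) ` range (s n)"
      by (auto simp: sSuc)
    then show ?case using Suc by (meson finite_UnI finite_imageI finite_subset)
  qed (simp add: s0)
  have inc: "incseq (\<lambda>n. s n z)" for z
    by (rule incseq_SucI) (auto simp: sSuc)
  have bound: "ennreal (s n z) \<le> c z" for n z
    by (induction n) (use le in \<open>auto simp: s0 sSuc max_def\<close>)
  show thesis
  proof
    show "0 \<le> s n z" for n z
      using incseqD[OF inc, of 0 n z] by (simp add: s0)
    show "finite (range (s n))" for n by (rule fin)
    show "s n -` {v} \<in> \<R>" for n v
    proof (induction n arbitrary: v)
      case 0
      have "s 0 -` {v} = (if v = 0 then UNIV else {})" by (auto simp: s0)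
      then show ?case by simp
    next
      case (Suc n)
      \<comment> \<open>Off the rectangle the value \<open>v\<close> is an old value; on it
        \<open>v\<close> comes from any old \<open>w\<close> with
        \<open>max w (r n) = v\<close>.\<close>
      have "s (Suc n) -` {v} = (s n -` {v} - U n \<times> V n) \<union>
          (\<Union>w\<in>{w\<in>range (s n). max w (r n) = v}. s n -` {w}) \<inter> U n \<times> V n"
        by (auto simp: sSuc split: if_splits)
      moreover have "(\<Union>w\<in>{w\<in>range (s n). max w (r n) = v}. s n -` {w}) \<in> \<R>"
        using fin Suc by (intro finite_UN) auto
      moreover have "s n -` {v} - U n \<times> V n \<in> \<R>"
        using Suc rect[OF U V] by (rule Diff)
      ultimately show ?case using rect[OF U V] by (simp only: Un Int)
    qed
    show "incseq (\<lambda>n. s n z)" for z by (rule inc)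
    show "c z = (SUP n. ennreal (s n z))" for z
    proof (rule antisym)
      show "c z \<le> (SUP n. ennreal (s n z))"
      proof (rule dense_le)
        fix t assume "t < c z"
        then obtain k where k: "z \<in> U k \<times> V k" "t \<le> ennreal (r k)" using ex by blast
        have "r k \<le> s (Suc k) z" using k(1) by (simp add: sSuc)
        with k(2) have "t \<le> ennreal (s (Suc k) z)" by (meson ennreal_leI order_trans)
        then show "t \<le> (SUP n. ennreal (s n z))" by (rule SUP_upper2[OF UNIV_I])
      qed
    qed (auto intro: SUP_least bound)
  qed
qed

text \<open>\<open>D\<close> is any finite upper bound of the dual problem. When \<open>D\<close> is
  the dual supremum, weak duality makes the coupling found here optimal.\<close>

lemma coupling_le_of_dual_bound:
  fixes \<mu> \<nu> :: "'a::{second_countable_topology, t2_space} measure"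
    and c :: "'a \<times> 'a \<Rightarrow> ennreal"
  assumes \<mu>: "\<mu> \<in> finite_borel_measures" "compact_inner_regular \<mu>"
    and \<nu>: "\<nu> \<in> finite_borel_measures" "compact_inner_regular \<nu>"
    and c: "lower_semicontinuous c"
    and D: "\<And>\<phi> \<psi>. integrable \<mu> \<phi> \<Longrightarrow> integrable \<nu> \<psi> \<Longrightarrow>
      (\<And>x y. ennreal (\<phi> x + \<psi> y) \<le> c (x, y)) \<Longrightarrow> (\<integral>x. \<phi> x \<partial>\<mu>) + (\<integral>y. \<psi> y \<partial>\<nu>) \<le> D"
  obtains \<gamma> where "\<gamma> \<in> couplings \<mu> \<nu>" and "(\<integral>\<^sup>+z. c z \<partial>\<gamma>) \<le> ennreal D"
proof -
  have sets: "sets \<mu> = sets borel" "sets \<nu> = sets borel"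
    using \<mu>(1) \<nu>(1) by (auto simp: finite_borel_measures_def)
  then have space: "space \<mu> = UNIV" "space \<nu> = UNIV"
    by (auto dest: sets_eq_imp_space_eq)
  interpret \<mu>: finite_measure \<mu> using \<mu>(1) by (simp add: finite_borel_measures_def)
  interpret \<nu>: finite_measure \<nu> using \<nu>(1) by (simp add: finite_borel_measures_def)
  have D0: "0 \<le> D" using D[of "\<lambda>_. 0" "\<lambda>_. 0"] by simp
  define V where "V = {f :: 'a \<times> 'a \<Rightarrow> real. \<exists>M. \<forall>z. \<bar>f z\<bar> \<le> M}"
  interpret function_space V
  proof
    show "(\<lambda>_. 0) \<in> V" by (auto simp: V_def)
    show "(\<lambda>z. f z + g z) \<in> V" if fg: "f \<in> V" "g \<in> V" for f g
    proof -
      obtain M N where "\<And>z. \<bar>f z\<bar> \<le> M" "\<And>z. \<bar>g z\<bar> \<le> N" using fg by (auto simp: V_def)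
      then have "\<bar>f z + g z\<bar> \<le> M + N" for z by (meson abs_triangle_ineq add_mono order_trans)
      then show ?thesis by (auto simp: V_def)
    qed
    show "(\<lambda>z. r * f z) \<in> V" if f: "f \<in> V" for f r
    proof -
      obtain M where "\<And>z. \<bar>f z\<bar> \<le> M" using f by (auto simp: V_def)
      then have "\<bar>r * f z\<bar> \<le> \<bar>r\<bar> * M" for z by (simp add: abs_mult mult_left_mono)
      then show ?thesis by (auto simp: V_def)
    qed
  qed
  \<comment> \<open>Guarded by \<open>c < \<top>\<close> because \<open>enn2real \<top> = 0\<close>; at \<open>t = 0\<close> this is the limit of the constraints for
    \<open>t > 0\<close>, which are vacuous where \<open>c = \<top>\<close>.\<close>
  define feas where "feas f \<phi> \<psi> t \<longleftrightarrow> integrable \<mu> \<phi> \<and> integrable \<nu> \<psi> \<and> 0 \<le> t \<and>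
    (\<forall>x y. c (x, y) < \<top> \<longrightarrow> f (x, y) \<le> \<phi> x + \<psi> y + t * enn2real (c (x, y)))" for f \<phi> \<psi> t
  \<comment> \<open>The multiplier \<open>t\<close> of \<open>c\<close> is charged at the price
    \<open>D\<close>, because potentials below \<open>c\<close> integrate to at most
    \<open>D\<close>.\<close>
  define val where "val \<phi> \<psi> t = (\<integral>x. \<phi> x \<partial>\<mu>) + (\<integral>y. \<psi> y \<partial>\<nu>) + t * D" for \<phi> \<psi> and t :: real
  define S where "S f = {val \<phi> \<psi> t | \<phi> \<psi> t. feas f \<phi> \<psi> t}" for f
  have SI: "r \<in> S f" if "feas f \<phi> \<psi> t" "val \<phi> \<psi> t = r" for f \<phi> \<psi> t r
    using that unfolding S_def by blast
  have SE: "\<exists>\<phi> \<psi> t. feas f \<phi> \<psi> t \<and> val \<phi> \<psi> t = r" if "r \<in> S f" for f r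
    using that unfolding S_def by blast
  have feasI: "feas f \<phi> \<psi> t"
    if "integrable \<mu> \<phi>" "integrable \<nu> \<psi>" "0 \<le> t"
      "\<And>x y. c (x, y) < \<top> \<Longrightarrow> f (x, y) \<le> \<phi> x + \<psi> y + t * enn2real (c (x, y))" for f \<phi> \<psi> t
    using that unfolding feas_def by blast
  have feasD: "integrable \<mu> \<phi>" "integrable \<nu> \<psi>" "0 \<le> t"
      "\<And>x y. c (x, y) < \<top> \<Longrightarrow> f (x, y) \<le> \<phi> x + \<psi> y + t * enn2real (c (x, y))"
    if "feas f \<phi> \<psi> t" for f \<phi> \<psi> t
    using that unfolding feas_def by blast+
  obtain L where L_add: "\<And>f g. f \<in> V \<Longrightarrow> g \<in> V \<Longrightarrow> L (\<lambda>z. f z + g z) = L f + L g"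
    and L_scale: "\<And>f r. f \<in> V \<Longrightarrow> L (\<lambda>z. r * f z) = r * L f"
    and L_le: "\<And>f s. f \<in> V \<Longrightarrow> s \<in> S f \<Longrightarrow> L f \<le> s"
  proof (rule hahn_banach_cone)
    fix f assume "f \<in> V"
    then obtain M where "\<And>z. \<bar>f z\<bar> \<le> M" by (auto simp: V_def)
    then have "f z \<le> M" for z by (meson abs_ge_self order_trans)
    then have "feas f (\<lambda>_. M) (\<lambda>_. 0) 0" by (intro feasI) simp_all
    from SI[OF this refl] show "S f \<noteq> {}" by blast
  next
    fix f g s t assume "s \<in> S f" "t \<in> S g"
    then obtain \<phi> \<psi> u \<phi>' \<psi>' u' where f: "feas f \<phi> \<psi> u" and g: "feas g \<phi>' \<psi>' u'"
      and st: "val \<phi> \<psi> u = s" "val \<phi>' \<psi>' u' = t"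
      using SE by metis
    show "s + t \<in> S (\<lambda>z. f z + g z)"
    proof (rule SI)
      show "feas (\<lambda>z. f z + g z) (\<lambda>x. \<phi> x + \<phi>' x) (\<lambda>y. \<psi> y + \<psi>' y) (u + u')"
      proof (rule feasI)
        fix x y assume "c (x, y) < \<top>"
        from add_mono[OF feasD(4)[OF f this] feasD(4)[OF g this]]
        show "f (x, y) + g (x, y) \<le> \<phi> x + \<phi>' x + (\<psi> y + \<psi>' y) + (u + u') * enn2real (c (x, y))"
          by (simp add: algebra_simps)
      qed (use feasD(1-3)[OF f] feasD(1-3)[OF g] in auto)
      show "val (\<lambda>x. \<phi> x + \<phi>' x) (\<lambda>y. \<psi> y + \<psi>' y) (u + u') = s + t"
        unfolding st[symmetric] val_def using feasD(1,2)[OF f] feasD(1,2)[OF g]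
        by (simp add: distrib_right)
    qed
  next
    fix f s and r :: real assume r: "r > 0" and "s \<in> S f"
    then obtain \<phi> \<psi> u where f: "feas f \<phi> \<psi> u" and s: "val \<phi> \<psi> u = s"
      using SE by metis
    show "r * s \<in> S (\<lambda>z. r * f z)"
    proof (rule SI)
      show "feas (\<lambda>z. r * f z) (\<lambda>x. r * \<phi> x) (\<lambda>y. r * \<psi> y) (r * u)"
      proof (rule feasI)
        fix x y assume "c (x, y) < \<top>"
        from mult_left_mono[OF feasD(4)[OF f this], of r] r
        show "r * f (x, y) \<le> r * \<phi> x + r * \<psi> y + r * u * enn2real (c (x, y))"
          by (simp add: algebra_simps)
      qed (use feasD(1-3)[OF f] r in auto)
      show "val (\<lambda>x. r * \<phi> x) (\<lambda>y. r * \<psi> y) (r * u) = r * s"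
        unfolding s[symmetric] val_def by (simp add: distrib_left)
    qed
  next
    fix s assume "s \<in> S (\<lambda>_. 0)"
    then obtain \<phi> \<psi> t where f: "feas (\<lambda>_. 0) \<phi> \<psi> t" and s: "val \<phi> \<psi> t = s"
      using SE by metis
    \<comment> \<open>Division by \<open>t\<close> fails at \<open>t = 0\<close>, so
      \<open>t + e\<close> is used: \<open>- \<phi> / (t + e)\<close> and
      \<open>- \<psi> / (t + e)\<close> are admissible in the dual problem.\<close>
    have pos: "0 \<le> s + e * D" if e: "e > 0" for e
    proof -
      have te: "t + e > 0" using feasD(3)[OF f] e by simp
      have "(\<integral>x. - \<phi> x / (t + e) \<partial>\<mu>) + (\<integral>y. - \<psi> y / (t + e) \<partial>\<nu>) \<le> D"
      proof (rule D)
        fix x y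
        show "ennreal (- \<phi> x / (t + e) + - \<psi> y / (t + e)) \<le> c (x, y)"
        proof (cases "c (x, y) < \<top>")
          case True
          then have "- \<phi> x - \<psi> y \<le> t * enn2real (c (x, y))"
            using feasD(4)[OF f True] by simp
          also have "\<dots> \<le> (t + e) * enn2real (c (x, y))"
            using e by (intro mult_right_mono) auto
          finally have "(- \<phi> x - \<psi> y) / (t + e) \<le> enn2real (c (x, y))"
            using te by (simp add: pos_divide_le_eq mult.commute)
          then have "- \<phi> x / (t + e) + - \<psi> y / (t + e) \<le> enn2real (c (x, y))"
            by (simp add: diff_divide_distrib)
          then show ?thesis using True by (metis ennreal_enn2real ennreal_leI)
        qed (simp add: less_top[symmetric])
      qed (use feasD(1,2)[OF f] in auto)
      then have "(- (\<integral>x. \<phi> x \<partial>\<mu>) - (\<integral>y. \<psi> y \<partial>\<nu>)) / (t + e) \<le> D"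
        by (simp add: diff_divide_distrib)
      then have "- (\<integral>x. \<phi> x \<partial>\<mu>) - (\<integral>y. \<psi> y \<partial>\<nu>) \<le> (t + e) * D"
        using te by (simp add: pos_divide_le_eq mult.commute)
      then show ?thesis unfolding s[symmetric] val_def by (simp add: distrib_right)
    qed
    show "0 \<le> s"
    proof (rule ccontr)
      assume "\<not> 0 \<le> s"
      \<comment> \<open>This \<open>e\<close> gives \<open>s + e * D = s / (D + 1) < 0\<close>; the
        summand \<open>1\<close> covers \<open>D = 0\<close>.\<close>
      then show False using pos[of "- s / (D + 1)"] D0 by (simp add: field_simps)
    qed
  qed (rule that)
  have L_uminus: "L (\<lambda>z. - f z) = - L f" if "f \<in> V" for f
    using L_scale[OF that, of "-1"] by simp
  \<comment> \<open>The index type is \<open>real\<close> because the sums run over the values of a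
    step function.\<close>
  have L_sum: "(\<lambda>z. \<Sum>i\<in>I. f i z) \<in> V \<and> L (\<lambda>z. \<Sum>i\<in>I. f i z) = (\<Sum>i\<in>I. L (f i))"
    if "finite I" "\<And>i. i \<in> I \<Longrightarrow> f i \<in> V" for I :: "real set" and f
    using that
  proof (induction I rule: finite_induct)
    case empty
    then show ?case using L_scale[OF zero, of 0] zero by simp
  next
    case (insert i I)
    then show ?case using L_add[of "f i" "\<lambda>z. \<Sum>i\<in>I. f i z"] add[of "f i" "\<lambda>z. \<Sum>i\<in>I. f i z"]
      by simp
  qed
  define m where "m E = L (indicator E)" for E
  have ind: "indicator E \<in> V" for E
    by (auto simp: V_def indicator_def intro!: exI[of _ 1])
  have content: "content m"
  proof
    fix E F :: "('a \<times> 'a) set"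
    \<comment> \<open>Zero potentials dominate \<open>- indicator E\<close>, so \<open>L\<close> is
      nonnegative on indicators.\<close>
    have "feas (\<lambda>z. - indicator E z) (\<lambda>_. 0) (\<lambda>_. 0) 0" by (rule feasI) simp_all
    from L_le[OF uminus[OF ind] SI[OF this refl]] show "0 \<le> m E"
      by (simp add: L_uminus[OF ind] m_def val_def)
    assume "E \<inter> F = {}"
    then have "indicator (E \<union> F) = (\<lambda>z. indicator E z + indicator F z :: real)"
      by (auto simp: indicator_def fun_eq_iff)
    then show "m (E \<union> F) = m E + m F" using L_add[OF ind ind] by (simp add: m_def)
  qed
  have m_le: "m E \<le> val \<phi> \<psi> 0" if "feas (indicator E) \<phi> \<psi> 0" for E \<phi> \<psi>
    unfolding m_def by (rule L_le[OF ind SI[OF that refl]])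
  have m_ge: "- m E \<le> val \<phi> \<psi> 0" if "feas (\<lambda>z. - indicator E z) \<phi> \<psi> 0" for E \<phi> \<psi>
    unfolding m_def L_uminus[OF ind, symmetric] by (rule L_le[OF uminus[OF ind] SI[OF that refl]])
  have marg1: "m (A \<times> UNIV) = measure \<mu> A" if A: "A \<in> sets borel" for A
  proof (rule antisym)
    have int: "integrable \<mu> (indicator A :: 'a \<Rightarrow> real)"
      using A sets by (simp add: \<mu>.emeasure_finite less_top[symmetric])
    \<comment> \<open>This indicator and its negative both split exactly into potentials at
      \<open>t = 0\<close>, so the same integral bounds \<open>m\<close> from both sides.\<close>
    have "feas (indicator (A \<times> UNIV)) (indicator A) (\<lambda>_. 0) 0"
      using int by (intro feasI) (auto split: split_indicator)
    from m_le[OF this] show "m (A \<times> UNIV) \<le> measure \<mu> A"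
      using A sets space by (simp add: val_def)
    have "feas (\<lambda>z. - indicator (A \<times> UNIV) z) (\<lambda>x. - indicator A x) (\<lambda>_. 0) 0"
      using int by (intro feasI) (auto split: split_indicator)
    from m_ge[OF this] show "measure \<mu> A \<le> m (A \<times> UNIV)"
      using A sets space by (simp add: val_def)
  qed
  have marg2: "m (UNIV \<times> A) = measure \<nu> A" if A: "A \<in> sets borel" for A
  proof (rule antisym)
    have int: "integrable \<nu> (indicator A :: 'a \<Rightarrow> real)"
      using A sets by (simp add: \<nu>.emeasure_finite less_top[symmetric])
    have "feas (indicator (UNIV \<times> A)) (\<lambda>_. 0) (indicator A) 0"
      using int by (intro feasI) (auto split: split_indicator)
    from m_le[OF this] show "m (UNIV \<times> A) \<le> measure \<nu> A"
      using A sets space by (simp add: val_def)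
    have "feas (\<lambda>z. - indicator (UNIV \<times> A) z) (\<lambda>_. 0) (\<lambda>x. - indicator A x) 0"
      using int by (intro feasI) (auto split: split_indicator)
    from m_ge[OF this] show "measure \<nu> A \<le> m (UNIV \<times> A)"
      using A sets space by (simp add: val_def)
  qed
  obtain \<gamma> \<R> where \<gamma>: "\<gamma> \<in> couplings \<mu> \<nu>" and alg: "algebra UNIV \<R>" and \<R>: "\<R> \<subseteq> sets borel"
    and rect: "\<And>A B. A \<in> sets borel \<Longrightarrow> B \<in> sets borel \<Longrightarrow> A \<times> B \<in> \<R>"
    and em: "\<And>E. E \<in> \<R> \<Longrightarrow> emeasure \<gamma> E = ennreal (m E)"
    by (rule coupling_of_content[OF content \<mu> \<nu>], erule marg1, erule marg2, rule that)
  have sets\<gamma>: "sets \<gamma> = sets borel" using \<gamma> by (auto simp: couplings_def finite_borel_measures_def)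
  have rect_open: "U \<times> W \<in> \<R>" if "open U" "open W" for U W
    using that by (intro rect) auto
  obtain s :: "nat \<Rightarrow> 'a \<times> 'a \<Rightarrow> real" where s: "\<And>n z. 0 \<le> s n z" "\<And>n. finite (range (s n))" "\<And>n v. s n -` {v} \<in> \<R>"
    "\<And>z. incseq (\<lambda>n. s n z)" "\<And>z. c z = (SUP n. ennreal (s n z))"
    by (rule lower_semicontinuous_step_approx[OF c alg], erule rect_open, assumption, rule that)
  have meas: "s n -` {v} \<in> sets \<gamma>" for n v using s(3) \<R> sets\<gamma> by auto
  have s_sum: "s n z = (\<Sum>v\<in>range (s n). v * indicator (s n -` {v}) z)" for n z
  proof -
    have "(\<Sum>v\<in>range (s n). v * indicator (s n -` {v}) z) = (\<Sum>v\<in>range (s n). if v = s n z then v else 0)"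
      by (rule sum.cong) (auto simp: indicator_def)
    then show ?thesis using s(2) by simp
  qed
  have s_V: "s n \<in> V" and L_s: "L (s n) = (\<Sum>v\<in>range (s n). v * m (s n -` {v}))" for n
  proof -
    have "(\<lambda>z. v * indicator (s n -` {v}) z) \<in> V" for v by (rule scale[OF ind])
    from L_sum[of "range (s n)" "\<lambda>v z. v * indicator (s n -` {v}) z", OF s(2) this] show "s n \<in> V" "L (s n) = (\<Sum>v\<in>range (s n). v * m (s n -` {v}))"
      using L_scale[OF ind] by (simp_all add: s_sum[symmetric] m_def)
  qed
  \<comment> \<open>Both sides are the same finite sum over level sets in \<open>\<R>\<close>, where
    \<open>\<gamma>\<close> and \<open>m\<close> agree.\<close>
  have int_s: "(\<integral>\<^sup>+z. ennreal (s n z) \<partial>\<gamma>) = ennreal (L (s n))" for n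
  proof -
    have "(\<integral>\<^sup>+z. ennreal (s n z) \<partial>\<gamma>) =
        (\<integral>\<^sup>+z. (\<Sum>v\<in>range (s n). ennreal v * indicator (s n -` {v}) z) \<partial>\<gamma>)"
    proof (rule nn_integral_cong)
      fix z
      have "ennreal (s n z) = (\<Sum>v\<in>range (s n). ennreal (v * indicator (s n -` {v}) z))"
        unfolding s_sum[of n z] using s(1) by (subst sum_ennreal) auto
      also have "\<dots> = (\<Sum>v\<in>range (s n). ennreal v * indicator (s n -` {v}) z)"
        by (rule sum.cong) (auto simp: indicator_def)
      finally show "ennreal (s n z) = (\<Sum>v\<in>range (s n). ennreal v * indicator (s n -` {v}) z)" .
    qed
    also have "\<dots> = (\<Sum>v\<in>range (s n). ennreal v * emeasure \<gamma> (s n -` {v}))"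
      using meas by (subst nn_integral_sum) (auto simp: nn_integral_cmult_indicator)
    also have "\<dots> = (\<Sum>v\<in>range (s n). ennreal (v * m (s n -` {v})))"
      using s(1) em[OF s(3)] content.nonneg[OF content]
      by (intro sum.cong) (auto simp: ennreal_mult)
    also have "\<dots> = ennreal (L (s n))"
      unfolding L_s using s(1) content.nonneg[OF content] by (intro sum_ennreal) auto
    finally show ?thesis .
  qed
  have L_s_le: "L (s n) \<le> D" for n
  proof -
    have "s n z \<le> enn2real (c z)" if "c z < \<top>" for z
    proof -
      have "ennreal (s n z) \<le> c z" unfolding s(5) by (rule SUP_upper) simp
      then show ?thesis using that s(1) by (metis enn2real_ennreal enn2real_mono)
    qed
    \<comment> \<open>As \<open>s n \<le> c\<close>, zero potentials with multiplier
      \<open>1\<close> are feasible, and their value is \<open>D\<close>.\<close>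
    then have "feas (s n) (\<lambda>_. 0) (\<lambda>_. 0) 1" by (intro feasI) auto
    from L_le[OF s_V SI[OF this refl]] show ?thesis by (simp add: val_def)
  qed
  have meas_s: "(\<lambda>z. ennreal (s n z)) \<in> borel_measurable \<gamma>" for n
  proof -
    have "s n = (\<lambda>z. \<Sum>v\<in>range (s n). v * indicator (s n -` {v}) z)"
      by (rule ext) (rule s_sum)
    also have "\<dots> \<in> borel_measurable \<gamma>"
      using meas by (intro borel_measurable_sum borel_measurable_times borel_measurable_indicator
          borel_measurable_const)
    finally have "s n \<in> borel_measurable \<gamma>" .
    then show ?thesis by simp
  qed
  have "(\<integral>\<^sup>+z. c z \<partial>\<gamma>) = (\<integral>\<^sup>+z. (SUP n. ennreal (s n z)) \<partial>\<gamma>)" by (simp add: s(5))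
  also have "\<dots> = (SUP n. \<integral>\<^sup>+z. ennreal (s n z) \<partial>\<gamma>)"
    using s(4) by (intro nn_integral_monotone_convergence_SUP meas_s)
      (auto simp: incseq_def le_fun_def intro!: ennreal_leI)
  also have "\<dots> \<le> ennreal D"
    unfolding int_s using L_s_le by (auto intro!: SUP_least ennreal_leI)
  finally show thesis using \<gamma> that by blast
qed

section \<open>Weak duality and equality of the two values\<close>

text \<open>\<open>ennreal\<close> sends negative reals to \<open>0\<close>, which loses nothing
  against a nonnegative \<open>x\<close>. This translates the signed constraints on potentials into
  \<open>ennreal\<close>.\<close>

lemma ereal_le_enn2ereal_iff: "ereal r \<le> enn2ereal x \<longleftrightarrow> ennreal r \<le> x"
proof (cases "0 \<le> r")
  case True
  then show ?thesis by (simp add: less_eq_ennreal.rep_eq enn2ereal_ennreal)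
next
  case False
  then have "ereal r \<le> enn2ereal x" by (intro order_trans[OF _ enn2ereal_nonneg]) simp
  moreover have "ennreal r = 0" using False by (simp add: ennreal_neg)
  ultimately show ?thesis by simp
qed

lemma marginals_of_coupling:
  fixes \<mu> \<nu> :: "'a::second_countable_topology measure"
  assumes \<gamma>: "\<gamma> \<in> couplings \<mu> \<nu>" and sets: "sets \<mu> = sets borel" "sets \<nu> = sets borel"
  shows "fst \<in> \<gamma> \<rightarrow>\<^sub>M borel" and "snd \<in> \<gamma> \<rightarrow>\<^sub>M borel"
    and "distr \<gamma> borel fst = \<mu>" and "distr \<gamma> borel snd = \<nu>"
proof -
  have sets\<gamma>: "sets \<gamma> = sets borel"
    and marg: "\<And>A. A \<in> sets borel \<Longrightarrow> emeasure \<gamma> (A \<times> UNIV) = emeasure \<mu> A"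
      "\<And>A. A \<in> sets borel \<Longrightarrow> emeasure \<gamma> (UNIV \<times> A) = emeasure \<nu> A"
    using \<gamma> by (auto simp: couplings_def finite_borel_measures_def)
  have space\<gamma>: "space \<gamma> = UNIV" using sets_eq_imp_space_eq[OF sets\<gamma>] by simp
  have "(fst :: 'a \<times> 'a \<Rightarrow> 'a) \<in> borel \<rightarrow>\<^sub>M borel" "(snd :: 'a \<times> 'a \<Rightarrow> 'a) \<in> borel \<rightarrow>\<^sub>M borel"
    by (auto intro!: borel_measurable_continuous_onI continuous_intros)
  then show meas: "fst \<in> \<gamma> \<rightarrow>\<^sub>M borel" "snd \<in> \<gamma> \<rightarrow>\<^sub>M borel"
    using measurable_cong_sets[OF sets\<gamma> refl] by blast+
  have vimage: "fst -` A = A \<times> UNIV" "snd -` A = UNIV \<times> A" for A :: "'a set" by auto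
  show "distr \<gamma> borel fst = \<mu>"
    using meas sets by (intro measure_eqI) (auto simp: emeasure_distr space\<gamma> vimage marg)
  show "distr \<gamma> borel snd = \<nu>"
    using meas sets by (intro measure_eqI) (auto simp: emeasure_distr space\<gamma> vimage marg)
qed

text \<open>Passing to the positive part of \<open>f\<close> reduces this to monotonicity of the
  nonnegative integral.\<close>

lemma integral_le_nn_integral:
  assumes "\<And>z. ennreal (f z) \<le> c z"
  shows "ennreal (\<integral>z. f z \<partial>M) \<le> (\<integral>\<^sup>+z. c z \<partial>M)"
proof (cases "integrable M f")
  case True
  have "(\<integral>z. f z \<partial>M) \<le> (\<integral>z. max 0 (f z) \<partial>M)"
    using True by (intro integral_mono) auto
  then have "ennreal (\<integral>z. f z \<partial>M) \<le> ennreal (\<integral>z. max 0 (f z) \<partial>M)" by (rule ennreal_leI)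
  also have "\<dots> = (\<integral>\<^sup>+z. ennreal (max 0 (f z)) \<partial>M)"
    using True by (intro nn_integral_eq_integral[symmetric]) auto
  also have "\<dots> \<le> (\<integral>\<^sup>+z. c z \<partial>M)"
    using assms by (intro nn_integral_mono) (auto simp: max_def)
  finally show ?thesis .
\<comment> \<open>The integral of a function that is not integrable is \<open>0\<close> by
  convention.\<close>
qed (simp add: not_integrable_integral_eq)

text \<open>The two integrals are pulled back to \<open>\<gamma>\<close> along the projections,
  where they add up to a single one.\<close>

lemma kantorovich_weak_duality:
  fixes \<mu> \<nu> :: "'a::second_countable_topology measure"
  assumes \<gamma>: "\<gamma> \<in> couplings \<mu> \<nu>" and sets: "sets \<mu> = sets borel" "sets \<nu> = sets borel"
    and int: "integrable \<mu> \<phi>" "integrable \<nu> \<psi>"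
    and le: "\<And>x y. ennreal (\<phi> x + \<psi> y) \<le> c (x, y)"
  shows "ennreal ((\<integral>x. \<phi> x \<partial>\<mu>) + (\<integral>y. \<psi> y \<partial>\<nu>)) \<le> (\<integral>\<^sup>+z. c z \<partial>\<gamma>)"
proof -
  note marg = marginals_of_coupling[OF \<gamma> sets]
  have meas: "\<phi> \<in> borel_measurable borel" "\<psi> \<in> borel_measurable borel"
    using borel_measurable_integrable[OF int(1)] borel_measurable_integrable[OF int(2)]
      measurable_cong_sets[OF sets(1) refl] measurable_cong_sets[OF sets(2) refl] by blast+
  have "integrable (distr \<gamma> borel fst) \<phi>" "integrable (distr \<gamma> borel snd) \<psi>"
    using int by (simp_all only: marg)
  then have "integrable \<gamma> (\<lambda>z. \<phi> (fst z))" "integrable \<gamma> (\<lambda>z. \<psi> (snd z))"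
    using integrable_distr[OF marg(1)] integrable_distr[OF marg(2)] by blast+
  then have "(\<integral>z. \<phi> (fst z) + \<psi> (snd z) \<partial>\<gamma>) =
      (\<integral>x. \<phi> x \<partial>distr \<gamma> borel fst) + (\<integral>y. \<psi> y \<partial>distr \<gamma> borel snd)"
    using integral_distr[OF marg(1) meas(1)] integral_distr[OF marg(2) meas(2)] by simp
  moreover have "ennreal (\<phi> (fst z) + \<psi> (snd z)) \<le> c z" for z
    using le[of "fst z" "snd z"] by simp
  then have "ennreal (\<integral>z. \<phi> (fst z) + \<psi> (snd z) \<partial>\<gamma>) \<le> (\<integral>\<^sup>+z. c z \<partial>\<gamma>)"
    by (rule integral_le_nn_integral)
  ultimately show ?thesis by (simp add: marg)
qed

text \<open>Potentials are signed, so the supremum lives in \<open>ereal\<close>. Only a finite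
  supremum calls for the construction of a coupling.\<close>

theorem kantorovich_duality:
  fixes \<mu> \<nu> :: "'a::{second_countable_topology, t2_space} measure"
    and c :: "'a \<times> 'a \<Rightarrow> ennreal"
  assumes \<mu>: "\<mu> \<in> finite_borel_measures" "compact_inner_regular \<mu>"
    and \<nu>: "\<nu> \<in> finite_borel_measures" "compact_inner_regular \<nu>"
    and c: "lower_semicontinuous c"
  shows "Sup {ereal ((\<integral>x. \<phi> x \<partial>\<mu>) + (\<integral>y. \<psi> y \<partial>\<nu>)) | \<phi> \<psi>. integrable \<mu> \<phi> \<and> integrable \<nu> \<psi> \<and>
             (\<forall>x y. ereal (\<phi> x + \<psi> y) \<le> enn2ereal (c (x, y)))}
         = enn2ereal (INF \<gamma> \<in> couplings \<mu> \<nu>. \<integral>\<^sup>+z. c z \<partial>\<gamma>)"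
    (is "Sup ?S = enn2ereal ?I")
proof (rule antisym)
  have sets: "sets \<mu> = sets borel" "sets \<nu> = sets borel"
    using \<mu>(1) \<nu>(1) by (auto simp: finite_borel_measures_def)
  show "Sup ?S \<le> enn2ereal ?I"
  proof (rule Sup_least)
    fix r assume "r \<in> ?S"
    then obtain \<phi> \<psi> where r: "r = ereal ((\<integral>x. \<phi> x \<partial>\<mu>) + (\<integral>y. \<psi> y \<partial>\<nu>))"
      and int: "integrable \<mu> \<phi>" "integrable \<nu> \<psi>"
      and le: "\<And>x y. ennreal (\<phi> x + \<psi> y) \<le> c (x, y)"
      by (auto simp: ereal_le_enn2ereal_iff)
    have "ennreal ((\<integral>x. \<phi> x \<partial>\<mu>) + (\<integral>y. \<psi> y \<partial>\<nu>)) \<le> ?I"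
      by (rule INF_greatest, rule kantorovich_weak_duality[OF _ sets int le])
    then show "r \<le> enn2ereal ?I" unfolding r ereal_le_enn2ereal_iff .
  qed
  \<comment> \<open>The zero pair excludes a supremum of minus infinity and yields
    \<open>0 \<le> D\<close>.\<close>
  have zero: "ereal 0 \<in> ?S"
    by (intro CollectI exI[of _ "\<lambda>_. 0"]) (auto simp: ereal_le_enn2ereal_iff)
  show "enn2ereal ?I \<le> Sup ?S"
  proof (cases "Sup ?S")
    case (real D)
    obtain \<gamma> where \<gamma>: "\<gamma> \<in> couplings \<mu> \<nu>" "(\<integral>\<^sup>+z. c z \<partial>\<gamma>) \<le> ennreal D"
    proof (rule coupling_le_of_dual_bound[OF \<mu> \<nu> c])
      fix \<phi> \<psi> assume *: "integrable \<mu> \<phi>" "integrable \<nu> \<psi>" "\<And>x y. ennreal (\<phi> x + \<psi> y) \<le> c (x, y)"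
      have "ereal ((\<integral>x. \<phi> x \<partial>\<mu>) + (\<integral>y. \<psi> y \<partial>\<nu>)) \<le> Sup ?S"
        using * by (intro Sup_upper CollectI exI[of _ \<phi>] exI[of _ \<psi>])
          (auto simp: ereal_le_enn2ereal_iff)
      then show "(\<integral>x. \<phi> x \<partial>\<mu>) + (\<integral>y. \<psi> y \<partial>\<nu>) \<le> D" by (simp add: real)
    qed (rule that)
    have "0 \<le> D" using Sup_upper[OF zero] by (simp add: real)
    have "?I \<le> ennreal D" using \<gamma> by (rule INF_lower2)
    then have "enn2ereal ?I \<le> enn2ereal (ennreal D)" by (simp add: less_eq_ennreal.rep_eq)
    then show ?thesis using \<open>0 \<le> D\<close> by (simp add: real enn2ereal_ennreal)
  next
    case MInf
    show ?thesis using Sup_upper[OF zero] MInf by simp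
  qed simp
qed

section \<open>The space with an isolated point attached\<close>

lemma open_Some_image: "open U \<Longrightarrow> open (Some ` U)"
  by (simp add: open_option_def inj_vimage_image_eq)

lemma open_None: "open {None :: 'a::topological_space option}"
proof -
  have "Some -` {None :: 'a option} = {}" by auto
  then show ?thesis by (simp add: open_option_def)
qed

lemma isCont_Some: "isCont Some x"
  unfolding continuous_at_open
  by (metis open_option_def vimage_eq)

instance option :: (t2_space) t2_space
proof
  fix x y :: "'a option" assume "x \<noteq> y"
  note none = open_None open_Some_image[OF open_UNIV]
  show "\<exists>U V. open U \<and> open V \<and> x \<in> U \<and> y \<in> V \<and> U \<inter> V = {}"
  proof (cases x; cases y)
    fix u v assume xy: "x = Some u" "y = Some v"
    then obtain U V where "open U" "open V" "u \<in> U" "v \<in> V" "U \<inter> V = {}"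
      using hausdorff[of u v] \<open>x \<noteq> y\<close> by auto
    then show ?thesis using xy open_Some_image
      by (intro exI[of _ "Some ` U"] exI[of _ "Some ` V"]) auto
  next
    fix u assume "x = Some u" "y = None"
    then show ?thesis using none by (intro exI[of _ "range Some"] exI[of _ "{None}"]) auto
  next
    fix v assume "x = None" "y = Some v"
    then show ?thesis using none by (intro exI[of _ "{None}"] exI[of _ "range Some"]) auto
  qed (use \<open>x \<noteq> y\<close> in auto)
qed

text \<open>\<open>kantorovich_duality\<close> asks for this on the extended space, both for Borel
  sets of the square and for the steps over rectangles.\<close>

instance option :: (second_countable_topology) second_countable_topology
proof
  obtain A :: "'a set set" where A: "countable A" "topological_basis A"
    using ex_countable_basis by blast
  define B :: "'a option set set" where "B = insert {None} ((`) Some ` A)"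
  have "topological_basis B"
  proof (rule topological_basisI)
    fix U assume "U \<in> B"
    then show "open U"
      using topological_basis_open[OF A(2)] open_Some_image open_None by (auto simp: B_def)
  next
    fix O' :: "'a option set" and x assume O': "open O'" "x \<in> O'"
    show "\<exists>B'\<in>B. x \<in> B' \<and> B' \<subseteq> O'"
    proof (cases x)
      case None
      then show ?thesis using O' by (intro bexI[of _ "{None}"]) (auto simp: B_def)
    next
      case (Some u)
      then obtain A' where "A' \<in> A" "u \<in> A'" "A' \<subseteq> Some -` O'"
        using topological_basisE[OF A(2), of "Some -` O'" u] O' by (auto simp: open_option_def)
      then show ?thesis using Some by (intro bexI[of _ "Some ` A'"]) (auto simp: B_def)
    qed
  qed
  moreover have "countable B" using A(1) by (simp add: B_def)
  ultimately show "\<exists>B::'a option set set. countable B \<and> open = generate_topology B"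
    using topological_basis_imp_subbasis by blast
qed

section \<open>Regularity of the extended measures and of the extended cost\<close>

lemma compact_inner_regular_polish:
  fixes \<mu> :: "'a::polish_space measure"
  assumes "\<mu> \<in> finite_borel_measures"
  shows "compact_inner_regular \<mu>"
  unfolding compact_inner_regular_def
proof (intro ballI allI impI)
  have sets: "sets \<mu> = sets borel" using assms by (simp add: finite_borel_measures_def)
  interpret finite_measure \<mu> using assms by (simp add: finite_borel_measures_def)
  fix A :: "'a set" and e :: real assume A: "A \<in> sets borel" and e: "e > 0"
  show "\<exists>K\<subseteq>A. compact K \<and> measure \<mu> (A - K) \<le> e"
  \<comment> \<open>Small sets take \<open>K = {}\<close>; otherwise
    \<open>measure \<mu> A - e\<close> is positive and survives the conversion to
    \<open>ennreal\<close>.\<close>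
  proof (cases "measure \<mu> A \<le> e")
    case True
    then show ?thesis by (intro exI[of _ "{}"]) auto
  next
    case False
    have "ennreal (measure \<mu> A - e) < emeasure \<mu> A"
      using False e by (simp add: emeasure_eq_measure ennreal_lessI)
    then have "ennreal (measure \<mu> A - e) < (SUP K\<in>{K. K \<subseteq> A \<and> compact K}. emeasure \<mu> K)"
      using inner_regular[OF sets _ A] emeasure_finite by simp
    then obtain K where K: "K \<subseteq> A" "compact K" "ennreal (measure \<mu> A - e) < emeasure \<mu> K"
      unfolding less_SUP_iff by blast
    then have "measure \<mu> A - e < measure \<mu> K"
      using False by (simp add: emeasure_eq_measure ennreal_less_iff)
    then have "measure \<mu> (A - K) \<le> e"
      using finite_measure_Diff[of A K] A K sets by (simp add: borel_compact)
    then show ?thesis using K by blast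
  qed
qed

text \<open>The isolated point joins the compact set whenever it lies in \<open>A\<close>, so the
  atom at \<open>None\<close> adds nothing to the remainder.\<close>

lemma compact_inner_regular_hat_measure:
  fixes \<mu> \<nu> :: "'a::t2_space measure"
  assumes \<mu>: "\<mu> \<in> finite_borel_measures" "compact_inner_regular \<mu>"
  shows "compact_inner_regular (hat_measure \<mu> \<nu>)"
  unfolding compact_inner_regular_def
proof (intro ballI allI impI)
  have sets: "sets \<mu> = sets borel" using \<mu>(1) by (simp add: finite_borel_measures_def)
  fix A :: "'a option set" and e :: real assume A: "A \<in> sets borel" and e: "e > 0"
  have "Some -` A \<in> sets borel"
    using measurable_sets[OF measurable_Some_borel A] by simp
  then obtain K where K: "K \<subseteq> Some -` A" "compact K" "measure \<mu> (Some -` A - K) \<le> e"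
    using \<mu>(2) e unfolding compact_inner_regular_def by blast
  have "compact (Some ` K)"
    using isCont_Some K(2) by (intro compact_continuous_image continuous_at_imp_continuous_on) auto
  moreover have "compact (A \<inter> {None})" by (rule finite_imp_compact) simp
  ultimately have "compact (Some ` K \<union> (A \<inter> {None}))" (is "compact ?C") by (rule compact_Un)
  moreover from this have "emeasure (hat_measure \<mu> \<nu>) (A - ?C) = emeasure \<mu> (Some -` (A - ?C))"
    using A sets by (subst emeasure_hat_measure) (auto simp: borel_compact)
  moreover have "Some -` (A - ?C) = Some -` A - K" by auto
  ultimately have "compact ?C \<and> measure (hat_measure \<mu> \<nu>) (A - ?C) \<le> e"
    using K(3) by (simp add: measure_def)
  moreover have "?C \<subseteq> A" using K(1) by auto
  ultimately show "\<exists>K\<subseteq>A. compact K \<and> measure (hat_measure \<mu> \<nu>) (A - K) \<le> e" by blast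
qed

text \<open>The extended square splits into four open pieces; the cost is constant on three of them
  and equals \<open>b c\<close> on the fourth.\<close>

lemma lower_semicontinuous_hat_cost:
  fixes c :: "'a::topological_space \<times> 'a \<Rightarrow> ennreal"
  assumes c: "lower_semicontinuous c" and b: "b > 0"
  shows "lower_semicontinuous (hat_cost a b c)"
  unfolding lower_semicontinuous_def
proof
  fix t
  \<comment> \<open>As \<open>b > 0\<close>, superlevel sets of \<open>b c\<close> are superlevel
    sets of \<open>c\<close> at a rescaled height.\<close>
  have iff: "t < ennreal b * x \<longleftrightarrow> t / ennreal b < x" for x
    using b by (subst divide_less_ennreal) (auto simp: mult.commute)
  have open_c: "open {z. t < ennreal b * c z}"
    using c unfolding iff lower_semicontinuous_def by blast
  note open_range = open_Some_image[OF open_UNIV]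
  show "open {p. t < hat_cost a b c p}"
  proof (subst open_subopen, intro ballI)
    fix p assume "p \<in> {p. t < hat_cost a b c p}"
    then have p: "t < hat_cost a b c p" by simp
    obtain P Q where "open P" "open Q" "p \<in> P \<times> Q" "P \<times> Q \<subseteq> {p. t < hat_cost a b c p}"
    proof (cases p)
      case (Pair u v)
      show thesis
      proof (cases u; cases v)
        fix x y assume uv: "u = Some x" "v = Some y"
        then have "(x, y) \<in> {z. t < ennreal b * c z}" using p Pair by simp
        then obtain U V where "open U" "open V" "(x, y) \<in> U \<times> V" "U \<times> V \<subseteq> {z. t < ennreal b * c z}"
          using open_prod_elim[OF open_c] by metis
        then show thesis
          using uv Pair open_Some_image by (intro that[of "Some ` U" "Some ` V"]) auto
      next
        fix x assume "u = Some x" "v = None"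
        then show thesis
          using p Pair open_None open_range by (intro that[of "range Some" "{None}"]) auto
      next
        fix y assume "u = None" "v = Some y"
        then show thesis
          using p Pair open_None open_range by (intro that[of "{None}" "range Some"]) auto
      next
        assume "u = None" "v = None"
        then show thesis
          using p Pair open_None by (intro that[of "{None}" "{None}"]) auto
      qed
    qed
    then show "\<exists>T. open T \<and> p \<in> T \<and> T \<subseteq> {p. t < hat_cost a b c p}"
      by (intro exI[of _ "P \<times> Q"]) (auto intro: open_Times)
  qed
qed

text \<open>This is the general duality on \<open>'a option\<close>: the Polish topology of the
  original space gives compact inner regularity, which passes to the extended measures.\<close>

theorem corollary1p2:
  fixes \<mu>\<^sub>1 \<mu>\<^sub>2 :: "'a::polish_space measure"
    and a b :: real
    and c\<^sub>1 :: "'a \<times> 'a \<Rightarrow> ennreal"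
  assumes "locally_compact_space (euclidean :: 'a topology)"
    and "\<mu>\<^sub>1 \<in> finite_borel_measures" and "\<mu>\<^sub>2 \<in> finite_borel_measures"
    and "a > 0" and "b > 0"
    and "lower_semicontinuous c\<^sub>1"
  shows "Sup {ereal ((\<integral>x. \<phi>\<^sub>1 x \<partial>hat_measure \<mu>\<^sub>1 \<mu>\<^sub>2) + (\<integral>y. \<phi>\<^sub>2 y \<partial>hat_measure \<mu>\<^sub>2 \<mu>\<^sub>1)) | \<phi>\<^sub>1 \<phi>\<^sub>2 :: 'a option \<Rightarrow> real.
             integrable (hat_measure \<mu>\<^sub>1 \<mu>\<^sub>2) \<phi>\<^sub>1 \<and> integrable (hat_measure \<mu>\<^sub>2 \<mu>\<^sub>1) \<phi>\<^sub>2 \<and>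
             (\<forall>x y. ereal (\<phi>\<^sub>1 x + \<phi>\<^sub>2 y) \<le> enn2ereal (hat_cost a b c\<^sub>1 (x, y)))}
         = enn2ereal (INF \<gamma> \<in> couplings (hat_measure \<mu>\<^sub>1 \<mu>\<^sub>2) (hat_measure \<mu>\<^sub>2 \<mu>\<^sub>1).
             \<integral>\<^sup>+ p. hat_cost a b c\<^sub>1 p \<partial>\<gamma>)"
  using assms by (intro kantorovich_duality hat_measure_in_finite_borel_measures
      compact_inner_regular_hat_measure compact_inner_regular_polish lower_semicontinuous_hat_cost)

end
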